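(* Let $\mathbf{r}=(r(n))_{n\ge 0}$ be the Rudin-Shapiro sequence and let $\mathbf{r}'=(r'(n))_{n\ge 0}$ with $r'(n)=(-1)^n r(n)$. Then the abelian complexity functions of $\mathbf{r}$ and $\mathbf{r}'$ coincide, i.e. $\rho_{\mathbf{r}}(n)=\rho_{\mathbf{r}'}(n)=:\rho(n)$ for all $n$, and the sequence $(\rho(n))_{n\ge 0}$ is $2$-regular.
   Context: The Rudin-Shapiro sequence $\mathbf{r}\in\{-1,1\}^{\mathbb{N}}$ is defined by $r(0)=1$, $r(2n)=r(n)$, $r(2n+1)=(-1)^n r(n)$ for $n\ge 0$. For an infinite word $\mathbf{w}=w(0)w(1)\cdots$ over a finite alphabet $\mathcal{A}$, let $\mathcal{F}_{\mathbf{w}}(n)=\{w(i)w(i+1)\cdots w(i+n-1): i\ge 0\}$ be its set of factors of length $n$. Two finite words $u,v$ are abelian equivalent, $u\sim_{ab}v$, if $|u|_a=|v|_a$ for every letter $a\in\mathcal{A}$, where $|u|_a$ is the number of occurrences of $a$ in $u$. The abelian complexity function is $\rho_{\mathbf{w}}(n)=\#(\mathcal{F}_{\mathbf{w}}(n)/\sim_{ab})$ (so $\rho_{\mathbf{w}}(0)=1$). For an integer $k\ge 2$, the $k$-kernel of an integer sequence $(w(n))_{n\ge 0}$ is the set of subsequences $\{(w(k^e n+c))_{n\ge 0} : e\ge 0,\ 0\le c<k^e\}$. The sequence is $k$-regular if the $\mathbb{Z}$-module generated by its $k$-kernel is finitely generated. *)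

theory Defs
  imports Complex_Main "HOL-Library.Function_Algebras"
begin

function rudin_shapiro :: "nat \<Rightarrow> int" where
  "rudin_shapiro n =
     (if n = 0 then 1
      else if even n then rudin_shapiro (n div 2)
      else (-1) ^ (n div 2) * rudin_shapiro (n div 2))"
  by auto
termination
  by (relation "measure id") (auto elim: oddE)

declare rudin_shapiro.simps [simp del]

lemma rudin_shapiro_0: "rudin_shapiro 0 = 1"
  by (simp add: rudin_shapiro.simps)

lemma rudin_shapiro_even: "rudin_shapiro (2 * n) = rudin_shapiro n"
  by (cases "n = 0") (simp_all add: rudin_shapiro.simps [of "2 * n"] rudin_shapiro_0)

lemma rudin_shapiro_odd: "rudin_shapiro (2 * n + 1) = (-1) ^ n * rudin_shapiro n"
  by (simp add: rudin_shapiro.simps [of "Suc (2 * n)"])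

definition rudin_shapiro' :: "nat \<Rightarrow> int" where
  "rudin_shapiro' n = (-1) ^ n * rudin_shapiro n"

definition word_factors :: "(nat \<Rightarrow> 'a) \<Rightarrow> nat \<Rightarrow> 'a list set" where
  "word_factors w n = {map w [i..<i + n] | i. True}"

text \<open>
  Quantifying over the whole type of letters is harmless: letters outside the alphabet
  occur zero times in every word over the alphabet.
\<close>

definition abelian_equiv :: "'a list \<Rightarrow> 'a list \<Rightarrow> bool" where
  "abelian_equiv u v \<longleftrightarrow> (\<forall>a. count_list u a = count_list v a)"

text \<open>
  The cardinality below is the intended one for words over a finite alphabet, where
  there are finitely many factors of each length.
\<close>

definition abelian_complexity :: "(nat \<Rightarrow> 'a) \<Rightarrow> nat \<Rightarrow> nat" where
  "abelian_complexity w n =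
     card (word_factors w n //
       {(u, v). u \<in> word_factors w n \<and> v \<in> word_factors w n \<and> abelian_equiv u v})"

lemma equiv_abelian_equiv: "equiv F {(u, v). u \<in> F \<and> v \<in> F \<and> abelian_equiv u v}"
  by (auto simp: equiv_def refl_on_def sym_def trans_def abelian_equiv_def)

lemma abelian_complexity_0: "abelian_complexity w 0 = 1"
proof -
  have "word_factors w 0 = {[]}"
    by (auto simp: word_factors_def)
  then show ?thesis
    by (simp add: abelian_complexity_def quotient_def)
qed

definition k_kernel :: "nat \<Rightarrow> (nat \<Rightarrow> int) \<Rightarrow> (nat \<Rightarrow> int) set" where
  "k_kernel k w = {(\<lambda>n. w (k ^ e * n + c)) | e c. c < k ^ e}"

definition seq_scale :: "int \<Rightarrow> (nat \<Rightarrow> int) \<Rightarrow> (nat \<Rightarrow> int)" where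
  "seq_scale c f = (\<lambda>n. c * f n)"

interpretation int_seq: module seq_scale
  by unfold_locales (auto simp: seq_scale_def fun_eq_iff algebra_simps)

definition regular_seq :: "nat \<Rightarrow> (nat \<Rightarrow> int) \<Rightarrow> bool" where
  "regular_seq k w \<longleftrightarrow>
     k \<ge> 2 \<and> (\<exists>B. finite B \<and> int_seq.span B = int_seq.span (k_kernel k w))"

end

theory Submission
  imports Defs
begin

text \<open>
  A word over the letters $1$ and $-1$ of given length is determined up to abelian equivalence
  by the sum of its letters, so the abelian complexity at $n$ counts the values taken by the sums
  over windows of length $n$.

  The two complexities agree because each sequence contains the mirror images of all factors
  of the other: reading $r$ backwards from $2^{M+1}-1$ gives, up to a global sign, the beginning of
  $r'$, and vice versa (\<open>rudin_shapiro_reflect\<close>); the parity of $M$ makes the sign what it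
  has to be, and reversing a word does not change its sum.

  Let $M(n)$ (below \<open>rs_peak\<close>) be the largest sum of $n$ consecutive letters of $r$.
  The negative of every factor is a factor (\<open>rudin_shapiro_neg\<close>), so the smallest sum is
  $-M(n)$. Moving a window by one place changes its sum by $0$ or $\pm 2$, so all numbers in
  between with the parity of $n$ occur, and the complexity is $M(n)+1$.

  Over the four places $4n,\dots,4n+3$ the sequence $r$ reads $r(n),r(n),r'(n),-r'(n)$, with sum
  $2r(n)$. Hence a window of length $4n+b$ has a sum that is a combination of two windows of length
  $n$ or $n+1$, with at most two extra letters of $r'$ at the ends (\<open>rs_window_mod4\<close>). This
  bounds $M(4n+b)$ from above at once. The bounds are attained if some windows with sum
  $M(n)$ or $M(n+1)$ have suitable neighbouring letters. The three neighbourhoods needed are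
  the predicates \<open>flanked_peak\<close>, \<open>growing_peak\<close> and
  \<open>shrinking_peak\<close>; their point is that they reproduce
  themselves under $n \mapsto 4n+b$, so that one induction (\<open>ex_peak_windows\<close>) gives them for
  all lengths. The outcome is
  $$M(4n)=2M(n)+2 \ (n>0),\quad M(4n+1)=2M(n)+1,$$
  $$M(4n+2)=M(n)+M(n+1)+1,\quad M(4n+3)=2M(n+1)+1.$$

  Regularity follows: for $\rho=M+1$, the module spanned by $\rho(n)$, $\rho(n+1)$, $\rho(2n)$,
  $\rho(2n+1)$, $\rho(2n+2)$, the constant $1$ and a sequence supported at $0$ is closed under
  passing to even or odd places, and it is exactly the module spanned by the $2$-kernel.
\<close>

section \<open>The Rudin-Shapiro sequence along residue classes modulo 4\<close>

lemma rudin_shapiro_odd': "rudin_shapiro (2 * n + 1) = rudin_shapiro' n"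
  by (simp only: rudin_shapiro_odd rudin_shapiro'_def)

lemma rudin_shapiro'_even: "rudin_shapiro' (2 * n) = rudin_shapiro n"
  by (simp add: rudin_shapiro'_def rudin_shapiro_even)

lemma rudin_shapiro'_odd: "rudin_shapiro' (2 * n + 1) = - rudin_shapiro' n"
  unfolding rudin_shapiro'_def[of "2 * n + 1"] rudin_shapiro_odd' by simp

lemma rudin_shapiro_mod4:
  "rudin_shapiro (4 * n) = rudin_shapiro n"
  "rudin_shapiro (4 * n + 1) = rudin_shapiro n"
  "rudin_shapiro (4 * n + 2) = rudin_shapiro' n"
  "rudin_shapiro (4 * n + 3) = - rudin_shapiro' n"
proof -
  have "4 * n = 2 * (2 * n)" "4 * n + 1 = 2 * (2 * n) + 1"
    "4 * n + 2 = 2 * (2 * n + 1)" "4 * n + 3 = 2 * (2 * n + 1) + 1"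
    by simp_all
  then show "rudin_shapiro (4 * n) = rudin_shapiro n"
    "rudin_shapiro (4 * n + 1) = rudin_shapiro n"
    "rudin_shapiro (4 * n + 2) = rudin_shapiro' n"
    "rudin_shapiro (4 * n + 3) = - rudin_shapiro' n"
    by (simp_all only: rudin_shapiro_even rudin_shapiro_odd' rudin_shapiro'_even
          rudin_shapiro'_odd)
qed

lemma rudin_shapiro'_mod4:
  "rudin_shapiro' (4 * n) = rudin_shapiro n"
  "rudin_shapiro' (4 * n + 1) = - rudin_shapiro n"
  "rudin_shapiro' (4 * n + 2) = rudin_shapiro' n"
  "rudin_shapiro' (4 * n + 3) = rudin_shapiro' n"
  using rudin_shapiro_mod4[of n] by (simp_all add: rudin_shapiro'_def)

lemma rudin_shapiro_cases: "rudin_shapiro n = 1 \<or> rudin_shapiro n = -1"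
proof (induction n rule: rudin_shapiro.induct)
  case (1 n)
  then show ?case
    by (subst (1 2) rudin_shapiro.simps) (auto simp: minus_one_power_iff)
qed

lemma rudin_shapiro'_cases: "rudin_shapiro' n = 1 \<or> rudin_shapiro' n = -1"
  using rudin_shapiro_cases[of n] by (auto simp: rudin_shapiro'_def minus_one_power_iff)

section \<open>Sums over windows\<close>

definition window_sum :: "(nat \<Rightarrow> int) \<Rightarrow> nat \<Rightarrow> nat \<Rightarrow> int" where
  "window_sum w i n = (\<Sum>k<n. w (i + k))"

definition rs_partial_sum :: "nat \<Rightarrow> int" where
  "rs_partial_sum n = (\<Sum>j<n. rudin_shapiro j)"

lemma rs_partial_sum_Suc: "rs_partial_sum (n + 1) = rs_partial_sum n + rudin_shapiro n"
  by (simp add: rs_partial_sum_def)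

lemma rs_partial_sum_mod4:
  "rs_partial_sum (4 * n) = 2 * rs_partial_sum n"
  "rs_partial_sum (4 * n + 1) = 2 * rs_partial_sum n + rudin_shapiro n"
  "rs_partial_sum (4 * n + 2) = 2 * rs_partial_sum n + 2 * rudin_shapiro n"
  "rs_partial_sum (4 * n + 3) = 2 * rs_partial_sum n + 2 * rudin_shapiro n + rudin_shapiro' n"
proof -
  have step: "rs_partial_sum (4 * n + 1) = rs_partial_sum (4 * n) + rudin_shapiro n"
    "rs_partial_sum (4 * n + 2) = rs_partial_sum (4 * n) + 2 * rudin_shapiro n"
    "rs_partial_sum (4 * n + 3) = rs_partial_sum (4 * n) + 2 * rudin_shapiro n + rudin_shapiro' n"
    "rs_partial_sum (4 * n + 4) = rs_partial_sum (4 * n) + 2 * rudin_shapiro n" for n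
    using rudin_shapiro_mod4[of n]
    by (simp_all add: rs_partial_sum_def eval_nat_numeral)
  show *: "rs_partial_sum (4 * n) = 2 * rs_partial_sum n"
  proof (induction n)
    case 0
    show ?case by (simp add: rs_partial_sum_def)
  next
    case (Suc n)
    then show ?case using step(4)[of n] rs_partial_sum_Suc[of n] by (simp add: algebra_simps)
  qed
  show "rs_partial_sum (4 * n + 1) = 2 * rs_partial_sum n + rudin_shapiro n"
    "rs_partial_sum (4 * n + 2) = 2 * rs_partial_sum n + 2 * rudin_shapiro n"
    "rs_partial_sum (4 * n + 3) = 2 * rs_partial_sum n + 2 * rudin_shapiro n + rudin_shapiro' n"
    using step[of n] * by simp_all
qed

abbreviation rs_window :: "nat \<Rightarrow> nat \<Rightarrow> int" where
  "rs_window \<equiv> window_sum rudin_shapiro"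

lemma rs_window_eq: "rs_window i n = rs_partial_sum (i + n) - rs_partial_sum i"
  by (induction n) (simp_all add: window_sum_def rs_partial_sum_def)

text \<open>
  The partial sum up to a place $4n+b$ is, up to a letter of $r'$, twice the partial sum up to $n$
  or $n+1$, or the sum of these two. Where the two ends have different types, writing
  the result with windows from $i$ and $i+1$ of lengths $n$ and $n+1$ keeps the letters of $r$
  out of the formulas.
\<close>

lemma rs_window_mod4:
  "rs_window (4 * i) (4 * n) = 2 * rs_window i n" (is ?A1)
  "rs_window (4 * i + 1) (4 * n) = rs_window i n + rs_window (i + 1) n" (is ?A2)
  "rs_window (4 * i + 2) (4 * n) = 2 * rs_window (i + 1) n" (is ?A3)
  "rs_window (4 * i + 3) (4 * n) = 2 * rs_window (i + 1) n + rudin_shapiro' (i + n) - rudin_shapiro' i" (is ?A4)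
  "rs_window (4 * i) (4 * n + 1) = rs_window i n + rs_window i (n + 1)" (is ?B1)
  "rs_window (4 * i + 1) (4 * n + 1) = rs_window (i + 1) n + rs_window i (n + 1)" (is ?B2)
  "rs_window (4 * i + 2) (4 * n + 1) = 2 * rs_window (i + 1) n + rudin_shapiro' (i + n)" (is ?B3)
  "rs_window (4 * i + 3) (4 * n + 1) = 2 * rs_window (i + 1) n - rudin_shapiro' i" (is ?B4)
  "rs_window (4 * i) (4 * n + 2) = 2 * rs_window i (n + 1)" (is ?C1)
  "rs_window (4 * i + 1) (4 * n + 2) = rs_window (i + 1) n + rs_window i (n + 1) + rudin_shapiro' (i + n)" (is ?C2)
  "rs_window (4 * i + 2) (4 * n + 2) = 2 * rs_window (i + 1) n" (is ?C3)
  "rs_window (4 * i + 3) (4 * n + 2) = rs_window (i + 1) n + rs_window (i + 1) (n + 1) - rudin_shapiro' i" (is ?C4)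
  "rs_window (4 * i) (4 * n + 3) = 2 * rs_window i (n + 1) + rudin_shapiro' (i + n)" (is ?D1)
  "rs_window (4 * i + 1) (4 * n + 3) = rs_window (i + 1) n + rs_window i (n + 1)" (is ?D2)
  "rs_window (4 * i + 2) (4 * n + 3) = rs_window (i + 1) n + rs_window (i + 1) (n + 1)" (is ?D3)
  "rs_window (4 * i + 3) (4 * n + 3) = 2 * rs_window (i + 1) (n + 1) - rudin_shapiro' i" (is ?D4)
proof -
  have index: "4 * i + 4 * n = 4 * (i + n)" "4 * i + 1 + 4 * n = 4 * (i + n) + 1"
    "4 * i + 2 + 4 * n = 4 * (i + n) + 2" "4 * i + 3 + 4 * n = 4 * (i + n) + 3"
    "4 * i + (4 * n + 1) = 4 * (i + n) + 1" "4 * i + 1 + (4 * n + 1) = 4 * (i + n) + 2"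
    "4 * i + 2 + (4 * n + 1) = 4 * (i + n) + 3" "4 * i + 3 + (4 * n + 1) = 4 * (i + n + 1)"
    "4 * i + (4 * n + 2) = 4 * (i + n) + 2" "4 * i + 1 + (4 * n + 2) = 4 * (i + n) + 3"
    "4 * i + 2 + (4 * n + 2) = 4 * (i + n + 1)" "4 * i + 3 + (4 * n + 2) = 4 * (i + n + 1) + 1"
    "4 * i + (4 * n + 3) = 4 * (i + n) + 3" "4 * i + 1 + (4 * n + 3) = 4 * (i + n + 1)"
    "4 * i + 2 + (4 * n + 3) = 4 * (i + n + 1) + 1" "4 * i + 3 + (4 * n + 3) = 4 * (i + n + 1) + 2"
    "i + 1 + n = i + n + 1" "i + (n + 1) = i + n + 1" "i + 1 + (n + 1) = i + n + 1 + 1"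
    by simp_all
  show ?A1 ?A2 ?A3 ?A4 ?B1 ?B2 ?B3 ?B4 ?C1 ?C2 ?C3 ?C4 ?D1 ?D2 ?D3 ?D4
    by (simp_all only: rs_window_eq index rs_partial_sum_mod4 rudin_shapiro_mod4 rs_partial_sum_Suc)
      (simp_all add: algebra_simps)
qed

lemma rs_window_Suc:
  "rs_window i (n + 1) = rs_window i n + rudin_shapiro (i + n)"
  "rs_window i (n + 1) = rs_window (i + 1) n + rudin_shapiro i"
  using rs_partial_sum_Suc[of i] rs_partial_sum_Suc[of "i + n"]
  by (simp_all add: rs_window_eq algebra_simps)

section \<open>The largest window sum\<close>

text \<open>
  Finiteness makes the maximum below meaningful.
\<close>

lemma finite_window_sums:
  assumes "\<And>j. \<bar>w j\<bar> \<le> 1"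
  shows "finite (range (\<lambda>i. window_sum w i n))"
proof -
  have "\<bar>window_sum w i n\<bar> \<le> int n" for i
  proof (induction n)
    case (Suc n)
    have "window_sum w i (Suc n) = window_sum w i n + w (i + n)"
      by (simp add: window_sum_def)
    then show ?case using Suc assms[of "i + n"] by linarith
  qed (simp add: window_sum_def)
  then have "range (\<lambda>i. window_sum w i n) \<subseteq> {- int n..int n}"
    by (auto simp: abs_le_iff minus_le_iff)
  then show ?thesis by (rule finite_subset) simp
qed

lemma finite_rs_windows: "finite (range (\<lambda>i. rs_window i n))"
  by (rule finite_window_sums) (use rudin_shapiro_cases in \<open>metis abs_minus abs_1 order_refl\<close>)

definition rs_peak :: "nat \<Rightarrow> int" where
  "rs_peak n = Max (range (\<lambda>i. rs_window i n))"

lemma rs_window_le_peak: "rs_window i n \<le> rs_peak n"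
  unfolding rs_peak_def by (intro Max_ge finite_rs_windows) auto

lemma rs_peak_attained: "\<exists>i. rs_window i n = rs_peak n"
  using Max_in[OF finite_rs_windows[of n]] unfolding rs_peak_def by force

lemma rs_peak_eqI:
  assumes "rs_window i n = a" "\<And>j. rs_window j n \<le> a"
  shows "rs_peak n = a"
  unfolding rs_peak_def using assms by (intro Max_eqI finite_rs_windows) auto

lemma rs_peak_0: "rs_peak 0 = 0"
  by (rule rs_peak_eqI) (auto simp: window_sum_def)

text \<open>
  Each of the four bounds is the worst case over the position of the window modulo 4. Windows
  $2 S$ over a single length are compared with mixed terms $S_n + S_{n+1}$ through the identities
  \<open>rs_window_Suc\<close>, which cost at most one letter.
\<close>

lemma rs_window_upper:
  "rs_window x (4 * n) \<le> 2 * rs_peak n + 2"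
  "rs_window x (4 * n + 1) \<le> 2 * rs_peak n + 1"
  "rs_window x (4 * n + 2) \<le> rs_peak n + rs_peak (n + 1) + 1"
  "rs_window x (4 * n + 3) \<le> 2 * rs_peak (n + 1) + 1"
proof -
  define i where "i = x div 4"
  have x: "x = 4 * i \<or> x = 4 * i + 1 \<or> x = 4 * i + 2 \<or> x = 4 * i + 3"
    unfolding i_def by presburger
  note bounds = rs_window_le_peak[of i n] rs_window_le_peak[of "i + 1" n]
    rs_window_le_peak[of i "n + 1"] rs_window_le_peak[of "i + 1" "n + 1"]
  note steps = rs_window_Suc[of i n] rs_window_Suc[of "i + 1" n]
  have letters: "rudin_shapiro j \<le> 1" "- 1 \<le> rudin_shapiro j"
    "rudin_shapiro' j \<le> 1" "- 1 \<le> rudin_shapiro' j" for j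
    using rudin_shapiro_cases[of j] rudin_shapiro'_cases[of j] by auto
  note letters = letters[of i] letters[of "i + n"] letters[of "i + 1 + n"]
  show "rs_window x (4 * n) \<le> 2 * rs_peak n + 2"
    using x by (elim disjE; simp only: rs_window_mod4; use bounds letters in linarith)
  show "rs_window x (4 * n + 1) \<le> 2 * rs_peak n + 1"
    using x by (elim disjE; simp only: rs_window_mod4; use bounds letters steps in linarith)
  show "rs_window x (4 * n + 2) \<le> rs_peak n + rs_peak (n + 1) + 1"
    using x by (elim disjE; simp only: rs_window_mod4; use bounds letters steps in linarith)
  show "rs_window x (4 * n + 3) \<le> 2 * rs_peak (n + 1) + 1"
    using x by (elim disjE; simp only: rs_window_mod4; use bounds letters steps in linarith)
qed

section \<open>Windows of largest sum with prescribed neighbours\<close>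

text \<open>
  The bounds for lengths $4n$, $4n+1$ and $4n+3$ are attained by windows whose ends fall next to the
  last letter $-r'$ of a block of four. Such a letter is worth including at the left end
  and worth leaving out at the right end, which asks for $r'(i)=-1$ just before a window of largest
  sum and for $r'(i+n)=1$ at its last place. For length $4n+2$, two nested
  windows of lengths $n$ and $n+1$ must both have largest sum. If $M(n+1)=M(n)+1$, the longer one is
  obtained by appending the letter $1$ on the right; if $M(n+1)=M(n)-1$, the shorter one is obtained
  by dropping the letter $-1$ on the left. The extra conditions on $r'$ are those that
  survive the passage to length $4n+b$.
\<close>

definition flanked_peak :: "nat \<Rightarrow> nat \<Rightarrow> bool" where
  "flanked_peak n i \<longleftrightarrow>
     rs_window (i + 1) n = rs_peak n \<and> rudin_shapiro' i = -1 \<and> rudin_shapiro' (i + n) = 1"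

definition growing_peak :: "nat \<Rightarrow> nat \<Rightarrow> bool" where
  "growing_peak n i \<longleftrightarrow>
     rs_window (i + 1) n = rs_peak n \<and> rudin_shapiro' i = -1 \<and> rudin_shapiro (i + n + 1) = 1"

definition shrinking_peak :: "nat \<Rightarrow> nat \<Rightarrow> bool" where
  "shrinking_peak n i \<longleftrightarrow>
     rs_window i (n + 1) = rs_peak (n + 1) \<and> rudin_shapiro i = -1 \<and> rudin_shapiro' (i + n) = 1"

lemma rs_peak_Suc_le: "rs_peak (n + 1) \<le> rs_peak n + 1" "rs_peak n \<le> rs_peak (n + 1) + 1"
proof -
  obtain i j where ij: "rs_window i n = rs_peak n" "rs_window j (n + 1) = rs_peak (n + 1)"
    using rs_peak_attained by metis
  show "rs_peak (n + 1) \<le> rs_peak n + 1"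
    using rs_window_Suc(1)[of j n] ij(2) rs_window_le_peak[of j n] rudin_shapiro_cases[of "j + n"]
    by auto
  show "rs_peak n \<le> rs_peak (n + 1) + 1"
    using rs_window_Suc(1)[of i n] ij(1) rs_window_le_peak[of i "n + 1"] rudin_shapiro_cases[of "i + n"]
    by auto
qed

text \<open>
  The neighbouring letter changes the sum by one, and $M(n)$ and $M(n+1)$ differ by at most one, so the
  second window has largest sum as well.
\<close>

lemma growing_peakD:
  assumes "growing_peak n i"
  shows "rs_window (i + 1) n = rs_peak n" "rs_window (i + 1) (n + 1) = rs_peak (n + 1)"
    "rs_peak (n + 1) = rs_peak n + 1" "rudin_shapiro' i = -1" "rudin_shapiro (i + n + 1) = 1"
  using assms rs_window_Suc(1)[of "i + 1" n] rs_window_le_peak[of "i + 1" "n + 1"] rs_peak_Suc_le[of n]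
  by (simp_all add: growing_peak_def)

lemma shrinking_peakD:
  assumes "shrinking_peak n i"
  shows "rs_window (i + 1) n = rs_peak n" "rs_window i (n + 1) = rs_peak (n + 1)"
    "rs_peak (n + 1) = rs_peak n - 1" "rudin_shapiro i = -1" "rudin_shapiro' (i + n) = 1"
  using assms rs_window_Suc(2)[of i n] rs_window_le_peak[of "i + 1" n] rs_peak_Suc_le[of n]
  by (simp_all add: shrinking_peak_def)


lemma rs_peak_upper:
  "rs_peak (4 * n) \<le> 2 * rs_peak n + 2"
  "rs_peak (4 * n + 1) \<le> 2 * rs_peak n + 1"
  "rs_peak (4 * n + 2) \<le> rs_peak n + rs_peak (n + 1) + 1"
  "rs_peak (4 * n + 3) \<le> 2 * rs_peak (n + 1) + 1"
  using rs_window_upper rs_peak_attained by metis+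

text \<open>
  A window that reaches the upper bound determines $M(4n+b)$, and its neighbours, read off from
  the blocks they lie in, give one of the three properties for length $4n+b$.
\<close>

lemma flanked_peak_lift:
  assumes "flanked_peak n i"
  shows "rs_window (4 * i + 3) (4 * n) = 2 * rs_peak n + 2"
    "rs_window (4 * i + 3) (4 * n + 1) = 2 * rs_peak n + 1"
    "flanked_peak (4 * n) (4 * i + 2)"
    "shrinking_peak (4 * n) (4 * i + 2)"
    "flanked_peak (4 * n + 1) (4 * i + 2)"
proof -
  note i = assms[unfolded flanked_peak_def]
  have index: "4 * i + 2 + 1 = 4 * i + 3" "4 * i + 2 + 4 * n = 4 * (i + n) + 2"
    "4 * i + 2 + (4 * n + 1) = 4 * (i + n) + 3"
    by simp_all
  show w: "rs_window (4 * i + 3) (4 * n) = 2 * rs_peak n + 2"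
    "rs_window (4 * i + 3) (4 * n + 1) = 2 * rs_peak n + 1"
    using i by (simp_all only: rs_window_mod4)
  have w': "rs_window (4 * i + 2) (4 * n + 1) = 2 * rs_peak n + 1"
    using i by (simp only: rs_window_mod4)
  have p: "rs_peak (4 * n) = 2 * rs_peak n + 2" "rs_peak (4 * n + 1) = 2 * rs_peak n + 1"
    using w rs_peak_upper(1,2)[of n] rs_window_le_peak[of "4 * i + 3"] by (metis antisym)+
  show "flanked_peak (4 * n) (4 * i + 2)" "shrinking_peak (4 * n) (4 * i + 2)"
    "flanked_peak (4 * n + 1) (4 * i + 2)"
    unfolding flanked_peak_def shrinking_peak_def index w w' p
      rudin_shapiro_mod4 rudin_shapiro'_mod4
    using i by blast+
qed

text \<open>
  The length $4n+3$ inherits from $n+1$. Two windows of the same sum serve here: the one starting at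
  $4(i+1)$ has the neighbours for \<open>flanked_peak\<close>, the one starting at $4i+3$ those for
  \<open>growing_peak\<close>.
\<close>

lemma flanked_peak_lift_Suc:
  assumes "flanked_peak (n + 1) i"
  shows "rs_window (4 * i + 3) (4 * n + 3) = 2 * rs_peak (n + 1) + 1"
    "flanked_peak (4 * n + 3) (4 * i + 3)"
    "growing_peak (4 * n + 3) (4 * i + 2)"
proof -
  note i = assms[unfolded flanked_peak_def]
  have index: "4 * i + 2 + 1 = 4 * i + 3" "4 * i + 3 + 1 = 4 * (i + 1)"
    "4 * i + 3 + (4 * n + 3) = 4 * (i + (n + 1)) + 2"
    "4 * i + 2 + (4 * n + 3) + 1 = 4 * (i + (n + 1)) + 2"
    by simp_all
  show w: "rs_window (4 * i + 3) (4 * n + 3) = 2 * rs_peak (n + 1) + 1"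
    using i by (simp only: rs_window_mod4)
  have w': "rs_window (4 * (i + 1)) (4 * n + 3) = 2 * rs_peak (n + 1) + 1"
    using i by (simp only: rs_window_mod4) (simp add: algebra_simps)
  have p: "rs_peak (4 * n + 3) = 2 * rs_peak (n + 1) + 1"
    using w rs_peak_upper(4)[of n] rs_window_le_peak[of "4 * i + 3"] by (metis antisym)
  show "flanked_peak (4 * n + 3) (4 * i + 3)" "growing_peak (4 * n + 3) (4 * i + 2)"
    unfolding flanked_peak_def growing_peak_def index w w' p
      rudin_shapiro_mod4 rudin_shapiro'_mod4
    using i by blast+
qed

lemma growing_peak_lift:
  assumes "growing_peak n i"
  shows "rs_window (4 * i + 3) (4 * n + 2) = rs_peak n + rs_peak (n + 1) + 1"
    "growing_peak (4 * n + 1) (4 * i + 2)"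
    "flanked_peak (4 * n + 2) (4 * i + 2)"
    "growing_peak (4 * n + 2) (4 * i + 2)"
proof -
  note i = growing_peakD[OF assms]
  have index: "4 * i + 2 + 1 = 4 * i + 3"
    "4 * i + 2 + (4 * n + 1) + 1 = 4 * (i + n + 1)"
    "4 * i + 2 + (4 * n + 2) = 4 * (i + n + 1)"
    "4 * i + 2 + (4 * n + 2) + 1 = 4 * (i + n + 1) + 1"
    by simp_all
  have w1: "rs_window (4 * i + 3) (4 * n + 1) = 2 * rs_peak n + 1"
    by (simp only: rs_window_mod4 i)
  show w2: "rs_window (4 * i + 3) (4 * n + 2) = rs_peak n + rs_peak (n + 1) + 1"
    by (simp only: rs_window_mod4 i)
  have p: "rs_peak (4 * n + 1) = 2 * rs_peak n + 1"
    "rs_peak (4 * n + 2) = rs_peak n + rs_peak (n + 1) + 1"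
    using w1 w2 rs_peak_upper(2,3)[of n] rs_window_le_peak[of "4 * i + 3"] by (metis antisym)+
  show "growing_peak (4 * n + 1) (4 * i + 2)" "flanked_peak (4 * n + 2) (4 * i + 2)"
    "growing_peak (4 * n + 2) (4 * i + 2)"
    unfolding flanked_peak_def growing_peak_def index w1 w2 p
      rudin_shapiro_mod4 rudin_shapiro'_mod4
    using i by blast+
qed

lemma shrinking_peak_lift:
  assumes "shrinking_peak n i"
  shows "rs_window (4 * i + 1) (4 * n + 2) = rs_peak n + rs_peak (n + 1) + 1"
    "shrinking_peak (4 * n + 1) (4 * i + 1)"
    "flanked_peak (4 * n + 2) (4 * i)"
    "shrinking_peak (4 * n + 2) (4 * i)"
proof -
  note i = shrinking_peakD[OF assms]
  have index: "4 * i + 1 + (4 * n + 1) = 4 * (i + n) + 2"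
    "4 * i + (4 * n + 2) = 4 * (i + n) + 2"
    "4 * n + 1 + 1 = 4 * n + 2" "4 * n + 2 + 1 = 4 * n + 3"
    by simp_all
  show w2: "rs_window (4 * i + 1) (4 * n + 2) = rs_peak n + rs_peak (n + 1) + 1"
    by (simp only: rs_window_mod4 i)
  have w3: "rs_window (4 * i) (4 * n + 3) = 2 * rs_peak (n + 1) + 1"
    by (simp only: rs_window_mod4 i)
  have p: "rs_peak (4 * n + 2) = rs_peak n + rs_peak (n + 1) + 1"
    "rs_peak (4 * n + 3) = 2 * rs_peak (n + 1) + 1"
    using w2 w3 rs_peak_upper(3,4)[of n] rs_window_le_peak by (metis antisym)+
  show "shrinking_peak (4 * n + 1) (4 * i + 1)" "flanked_peak (4 * n + 2) (4 * i)"
    "shrinking_peak (4 * n + 2) (4 * i)"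
    unfolding flanked_peak_def shrinking_peak_def index w2 w3 p
      rudin_shapiro_mod4 rudin_shapiro'_mod4
    using i by blast+
qed

lemma growing_peak_0: "growing_peak 0 1"
proof -
  have "rudin_shapiro 2 = 1" "rudin_shapiro' 1 = -1"
    using rudin_shapiro_mod4(3)[of 0] rudin_shapiro'_mod4(2)[of 0]
    by (simp_all add: rudin_shapiro_0 rudin_shapiro'_def numeral_2_eq_2)
  then show ?thesis
    by (simp add: growing_peak_def rs_peak_0 window_sum_def numeral_2_eq_2)
qed

lemma flanked_peak_1: "flanked_peak 1 1"
proof -
  have v: "rudin_shapiro 2 = 1" "rudin_shapiro' 1 = -1" "rudin_shapiro' 2 = 1"
    using rudin_shapiro_mod4(3)[of 0] rudin_shapiro'_mod4(2,3)[of 0]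
    by (simp_all add: rudin_shapiro_0 rudin_shapiro'_def numeral_2_eq_2)
  have one: "rs_window i 1 = rudin_shapiro i" for i
    by (simp add: window_sum_def)
  have "rs_peak 1 = 1"
    using growing_peakD(3)[OF growing_peak_0] rs_peak_0 by simp
  then show ?thesis
    using v by (simp add: flanked_peak_def one window_sum_def numeral_2_eq_2)
qed

text \<open>
  No position is flanked for length 0, since $r'(i)$ cannot be both $-1$ and $1$. This is why
  length 1 is a separate base case; the recurrence for $M(4n)$ indeed fails at $n=0$.
\<close>

lemma ex_peak_windows:
  "(n > 0 \<longrightarrow> (\<exists>i. flanked_peak n i)) \<and> ((\<exists>i. growing_peak n i) \<or> (\<exists>i. shrinking_peak n i))"
proof (induction n rule: less_induct)
  case (less N)
  define n where "n = N div 4"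
  have "N = 4 * n \<or> N = 4 * n + 1 \<or> N = 4 * n + 2 \<or> N = 4 * n + 3"
    unfolding n_def by presburger
  then consider "N = 0" | "N = 1" | "N = 4 * n" "n > 0" | "N = 4 * n + 1" "n > 0" | "N = 4 * n + 2" | "N = 4 * n + 3"
    by (cases "n = 0") auto
  then show ?case
  proof cases
    case 1
    then show ?thesis using growing_peak_0 by auto
  next
    case 2
    then show ?thesis
      using flanked_peak_1 growing_peak_lift(2)[OF growing_peak_0] by auto
  next
    case 3
    then obtain i where "flanked_peak n i" using less[of n] by auto
    then show ?thesis using 3 flanked_peak_lift by blast
  next
    case 4
    then have "\<exists>i. flanked_peak n i" "(\<exists>i. growing_peak n i) \<or> (\<exists>i. shrinking_peak n i)"
      using less[of n] by auto
    then show ?thesis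
      using 4 flanked_peak_lift(5) growing_peak_lift(2) shrinking_peak_lift(2) by blast
  next
    case 5
    then have "(\<exists>i. growing_peak n i) \<or> (\<exists>i. shrinking_peak n i)"
      using less[of n] by auto
    then show ?thesis
      using 5 growing_peak_lift(3,4) shrinking_peak_lift(3,4) by blast
  next
    case 6
    then obtain i where "flanked_peak (n + 1) i" using less[of "n + 1"] by auto
    then show ?thesis using 6 flanked_peak_lift_Suc by blast
  qed
qed

lemma rs_peak_rec:
  "n > 0 \<Longrightarrow> rs_peak (4 * n) = 2 * rs_peak n + 2"
  "rs_peak (4 * n + 1) = 2 * rs_peak n + 1"
  "rs_peak (4 * n + 2) = rs_peak n + rs_peak (n + 1) + 1"
  "rs_peak (4 * n + 3) = 2 * rs_peak (n + 1) + 1"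
proof -

  show "rs_peak (4 * n) = 2 * rs_peak n + 2" if "n > 0"
    using that ex_peak_windows[of n] flanked_peak_lift(1) rs_window_le_peak rs_peak_upper(1)
    by (metis antisym)
  show "rs_peak (4 * n + 1) = 2 * rs_peak n + 1"
  proof (cases "n = 0")
    case True
    then show ?thesis using growing_peakD(3)[OF growing_peak_0] rs_peak_0 by simp
  next
    case False
    then show ?thesis
      using ex_peak_windows[of n] flanked_peak_lift(2) rs_window_le_peak rs_peak_upper(2)
      by (metis antisym gr0I)
  qed
  show "rs_peak (4 * n + 2) = rs_peak n + rs_peak (n + 1) + 1"
    using ex_peak_windows[of n] growing_peak_lift(1) shrinking_peak_lift(1)
      rs_window_le_peak rs_peak_upper(3)
    by (metis antisym)
  show "rs_peak (4 * n + 3) = 2 * rs_peak (n + 1) + 1"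
    using ex_peak_windows[of "n + 1"] flanked_peak_lift_Suc(1) rs_window_le_peak rs_peak_upper(4)
    by (metis antisym add_gr_0 zero_less_one)
qed

section \<open>Negation and reflection of windows\<close>

text \<open>
  The sign $r(n)$ is the parity of the number of (possibly overlapping) blocks $11$ in binary. Writing $110$ in front of
  the digits of $j$, padded to length $k$, adds exactly one such block.
\<close>

lemma rudin_shapiro_neg: "j < 2 ^ k \<Longrightarrow> rudin_shapiro (6 * 2 ^ k + j) = - rudin_shapiro j"
proof (induction k arbitrary: j)
  case 0
  then show ?case
    using rudin_shapiro_mod4(3)[of 1] by (simp add: rudin_shapiro'_def rudin_shapiro_0
      rudin_shapiro.simps[of "Suc 0"])
next
  case (Suc k)
  define m where "m = j div 2"
  have m: "m < 2 ^ k" using Suc.prems by (simp add: m_def)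
  have "j = 2 * m \<or> j = 2 * m + 1" unfolding m_def by presburger
  then show ?case
  proof
    assume j: "j = 2 * m"
    then have "6 * 2 ^ Suc k + j = 2 * (6 * 2 ^ k + m)" by simp
    then show ?thesis using Suc.IH[OF m] j by (simp only: rudin_shapiro_even)
  next
    assume j: "j = 2 * m + 1"
    then have "6 * 2 ^ Suc k + j = 2 * (6 * 2 ^ k + m) + 1" by simp
    then show ?thesis using Suc.IH[OF m] j
      by (simp only: rudin_shapiro_odd power_add power_mult) simp
  qed
qed

lemma rs_window_neg: "\<exists>j. rs_window j n = - rs_window i n"
proof
  have "rudin_shapiro (6 * 2 ^ (i + n) + i + k) = - rudin_shapiro (i + k)" if "k < n" for k
  proof -
    have "i + k < 2 ^ (i + n)"
      using that less_exp[of "i + n"] by linarith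
    then show ?thesis using rudin_shapiro_neg[of "i + k" "i + n"] by (simp add: add.assoc)
  qed
  then show "rs_window (6 * 2 ^ (i + n) + i) n = - rs_window i n"
    by (simp add: window_sum_def sum_negf)
qed

text \<open>
  The reflection $j \mapsto 2^{M+1}-1-j$ complements binary digits; dropping the last digit thus
  commutes with it, and exchanges even and odd places. Each of the two identities
  reduces to one or the other of them for $M-1$, depending on the last digit of $j$, so they are
  proved together.
\<close>

lemma rudin_shapiro_reflect:
  "j < 2 ^ M \<Longrightarrow>
    rudin_shapiro (2 * 2 ^ M - Suc j) = (-1) ^ M * rudin_shapiro' j \<and>
    rudin_shapiro' (2 * 2 ^ M - Suc j) = - ((-1) ^ M) * rudin_shapiro j"
proof (induction M arbitrary: j)
  case 0
  then show ?case using rudin_shapiro_odd[of 0] by (simp add: rudin_shapiro'_def)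
next
  case (Suc M)
  define m where "m = j div 2"
  \<comment> \<open>The reflection of $m$ at the level below: the reflection of $j$ without its last digit.\<close>
  define l :: nat where "l = 2 * 2 ^ M - Suc m"
  have m: "m < 2 ^ M" using Suc.prems by (simp add: m_def)
  have IH: "rudin_shapiro l = (-1) ^ M * rudin_shapiro' m"
      "rudin_shapiro' l = - ((-1) ^ M) * rudin_shapiro m"
    using Suc.IH[OF m] by (simp_all add: l_def)
  have "j = 2 * m \<or> j = 2 * m + 1" unfolding m_def by presburger
  then have "j = 2 * m \<and> 2 * 2 ^ Suc M - Suc j = 2 * l + 1 \<or>
      j = 2 * m + 1 \<and> 2 * 2 ^ Suc M - Suc j = 2 * l"
    unfolding l_def using m by auto
  then show ?case
    by (elim disjE conjE) (simp_all only: rudin_shapiro_even rudin_shapiro_odd'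
        rudin_shapiro'_even rudin_shapiro'_odd IH, simp_all)
qed

lemma window_sum_reflect:
  assumes "\<And>j. j < i + n \<Longrightarrow> v (K - Suc j) = w j" "i + n \<le> K"
  shows "window_sum v (K - (i + n)) n = window_sum w i n"
proof -
  have "window_sum w i n = (\<Sum>k<n. w (i + (n - Suc k)))"
    unfolding window_sum_def by (rule sum.nat_diff_reindex[symmetric])
  also have "\<dots> = (\<Sum>k<n. v (K - (i + n) + k))"
  proof (rule sum.cong)
    fix k assume "k \<in> {..<n}"
    then have k: "k < n" by simp
    then have "K - Suc (i + (n - Suc k)) = K - (i + n) + k" using assms(2) by linarith
    then show "w (i + (n - Suc k)) = v (K - (i + n) + k)"
      using assms(1)[of "i + (n - Suc k)"] k by simp
  qed simp
  finally show ?thesis by (simp add: window_sum_def)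
qed

lemma range_window_sum_rudin_shapiro':
  "range (\<lambda>i. window_sum rudin_shapiro' i n) = range (\<lambda>i. rs_window i n)"
proof (intro subset_antisym subsetI; clarify)
  fix i
  have small: "i + n < 2 ^ M" if "M \<ge> i + n" for M :: nat
    using that less_exp[of M] by linarith
  {
    \<comment> \<open>An even exponent makes the sign in the first reflection identity positive,
      an odd one the sign in the second.\<close>
    define M where "M = 2 * (i + n)"
    have "window_sum rudin_shapiro (2 * 2 ^ M - (i + n)) n = window_sum rudin_shapiro' i n"
    proof (rule window_sum_reflect)
      fix j assume "j < i + n"
      then have "j < 2 ^ M" using small[of M] by (simp add: M_def)
      then show "rudin_shapiro (2 * 2 ^ M - Suc j) = rudin_shapiro' j"
        using rudin_shapiro_reflect[of j M] by (simp add: M_def)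
    qed (use small[of M] in \<open>simp add: M_def\<close>)
    then show "window_sum rudin_shapiro' i n \<in> range (\<lambda>i. rs_window i n)"
      by (metis rangeI)
  next
    define M where "M = 2 * (i + n) + 1"
    have "window_sum rudin_shapiro' (2 * 2 ^ M - (i + n)) n = window_sum rudin_shapiro i n"
    proof (rule window_sum_reflect)
      fix j assume "j < i + n"
      then have "j < 2 ^ M" using small[of M] by (simp add: M_def)
      then show "rudin_shapiro' (2 * 2 ^ M - Suc j) = rudin_shapiro j"
        using rudin_shapiro_reflect[of j M] by (simp add: M_def)
    qed (use small[of M] in \<open>simp add: M_def\<close>)
    then show "rs_window i n \<in> range (\<lambda>i. window_sum rudin_shapiro' i n)"
      by (metis rangeI)
  }
qed

section \<open>Abelian complexity of words with letters 1 and -1\<close>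

lemma card_quotient_kernel:
  "card (A // {(u, v). u \<in> A \<and> v \<in> A \<and> f u = f v}) = card (f ` A)"
proof -
  define fibre where "fibre y = {u \<in> A. f u = y}" for y
  have "{(u, v). u \<in> A \<and> v \<in> A \<and> f u = f v} `` {x} = fibre (f x)" if "x \<in> A" for x
    using that by (auto simp: fibre_def)
  then have "A // {(u, v). u \<in> A \<and> v \<in> A \<and> f u = f v} = fibre ` f ` A"
    by (auto simp: quotient_def)
  moreover have "inj_on fibre (f ` A)"
    by (auto simp: inj_on_def fibre_def)
  ultimately show ?thesis by (simp add: card_image)
qed

lemma count_list_unit_letters:
  fixes u :: "int list"
  assumes "set u \<subseteq> {1, -1}"
  shows "2 * int (count_list u 1) = int (length u) + sum_list u"
    "2 * int (count_list u (-1)) = int (length u) - sum_list u"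
  using assms by (induction u) auto

lemma abelian_equiv_unit_letters:
  fixes u v :: "int list"
  assumes "set u \<subseteq> {1, -1}" "set v \<subseteq> {1, -1}" "length u = length v"
  shows "abelian_equiv u v \<longleftrightarrow> sum_list u = sum_list v"
proof
  assume "abelian_equiv u v"
  then have "count_list u 1 = count_list v 1" by (simp add: abelian_equiv_def)
  then show "sum_list u = sum_list v"
    using count_list_unit_letters(1)[OF assms(1)] count_list_unit_letters(1)[OF assms(2)] assms(3)
    by simp
next
  assume s: "sum_list u = sum_list v"
  have "count_list u a = count_list v a" for a
  proof (cases "a = 1 \<or> a = -1")
    case True
    then show ?thesis
      using s count_list_unit_letters[OF assms(1)] count_list_unit_letters[OF assms(2)] assms(3)
      by auto
  next
    case False
    then have "a \<notin> set u" "a \<notin> set v" using assms by auto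
    then show ?thesis by (simp add: count_list_0_iff)
  qed
  then show "abelian_equiv u v" by (simp add: abelian_equiv_def)
qed

lemma abelian_complexity_unit_letters:
  fixes w :: "nat \<Rightarrow> int"
  assumes "\<And>j. w j = 1 \<or> w j = -1"
  shows "abelian_complexity w n = card (range (\<lambda>i. window_sum w i n))"
proof -
  have letters: "set u \<subseteq> {1, -1}" "length u = n" if "u \<in> word_factors w n" for u
    using that assms unfolding word_factors_def by (auto simp: subset_iff) metis
  have "{(u, v). u \<in> word_factors w n \<and> v \<in> word_factors w n \<and> abelian_equiv u v} =
      {(u, v). u \<in> word_factors w n \<and> v \<in> word_factors w n \<and> sum_list u = sum_list v}"
    using abelian_equiv_unit_letters letters by (intro Collect_cong) auto
  then have "abelian_complexity w n = card (sum_list ` word_factors w n)"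
    unfolding abelian_complexity_def by (simp only: card_quotient_kernel)
  moreover have "sum_list (map w [i..<i + n]) = window_sum w i n" for i
    by (induction n) (simp_all add: window_sum_def)
  then have "sum_list ` word_factors w n = range (\<lambda>i. window_sum w i n)"
    by (auto simp: word_factors_def image_iff) (metis)+
  ultimately show ?thesis by simp
qed

text \<open>
  A discrete intermediate value theorem. The minimum may come before or after the
  maximum, and the second case is the first one for $-f$.
\<close>

lemma range_unit_steps:
  fixes f :: "nat \<Rightarrow> int"
  assumes step: "\<And>i. \<bar>f (Suc i) - f i\<bar> \<le> 1"
    and a: "f p = a" "\<And>i. a \<le> f i" and b: "f q = b" "\<And>i. f i \<le> b"
  shows "range f = {a..b}"
proof -
  have "\<exists>i. f i = c" if c: "a \<le> c" "c \<le> b" for c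
  proof (cases "p \<le> q")
    case True
    then show ?thesis
      using nat_intermed_int_val[of p q f c] step a b c by auto
  next
    case False
    then show ?thesis
      using nat_intermed_int_val[of q p "\<lambda>i. - f i" "- c"] step a b c
      by (auto simp: abs_minus_commute algebra_simps)
  qed
  then show ?thesis using a(2) b(2) by (auto simp: image_iff) metis
qed

text \<open>
  Counting the letters 1 in a window, instead of summing, turns steps of $0$ or $\pm 2$ into steps
  of $0$ or $\pm 1$.
\<close>

lemma abelian_complexity_rudin_shapiro:
  "int (abelian_complexity rudin_shapiro n) = rs_peak n + 1"
proof -
  define f where "f i = (rs_window i n + int n) div 2" for i
  have "even (rs_window i n + int n)" for i
  proof (induction n)
    case (Suc n)
    then show ?case
      using rs_window_Suc(1)[of i n] rudin_shapiro_cases[of "i + n"] by auto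
  qed (simp add: window_sum_def)
  then have f: "2 * f i = rs_window i n + int n" for i by (simp add: f_def)
  have step: "\<bar>f (Suc i) - f i\<bar> \<le> 1" for i
    using f[of i] f[of "Suc i"] rs_window_Suc[of i n] rudin_shapiro_cases[of i]
      rudin_shapiro_cases[of "i + n"] by auto
  obtain q where q: "rs_window q n = rs_peak n" using rs_peak_attained by auto
  obtain p where p: "rs_window p n = - rs_peak n" using rs_window_neg[of n q] q by auto
  have upper: "f i \<le> f q" for i
    using f[of i] f[of q] q rs_window_le_peak[of i n] by linarith
  have lower: "f p \<le> f i" for i
    using f[of i] f[of p] p rs_window_le_peak rs_window_neg[of n i] by (smt (verit))
  have "range f = {f p..f q}"
    using range_unit_steps[of f p "f p" q "f q"] step upper lower by blast
  then have "card (range f) = nat (f q - f p + 1)" by simp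
  moreover have "f q - f p = rs_peak n" using f[of p] f[of q] p q by linarith
  moreover have "range (\<lambda>i. rs_window i n) = (\<lambda>y. 2 * y - int n) ` range f"
    using f by (auto simp: image_image)
  then have "card (range (\<lambda>i. rs_window i n)) = card (range f)"
    by (simp add: card_image inj_on_def)
  ultimately show ?thesis
    using abelian_complexity_unit_letters[of rudin_shapiro n, OF rudin_shapiro_cases] upper[of p] by simp
qed

section \<open>Regularity\<close>

text \<open>
  A submodule that contains $w$ and is closed under all decimations contains the $k$-kernel, because
  one more decimation puts one more base-$k$ digit on the index. It suffices to test the closure on
  generators, since decimation is linear.
\<close>

lemma regular_seqI:
  assumes k: "k \<ge> 2" and fin: "finite G" and w: "w \<in> int_seq.span G"
    and decimate: "\<And>g d. g \<in> G \<Longrightarrow> d < k \<Longrightarrow> (\<lambda>n. g (k * n + d)) \<in> int_seq.span G"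
    and G: "G \<subseteq> int_seq.span (k_kernel k w)"
  shows "regular_seq k w"
proof -
  have span_decimate: "(\<lambda>n. g (k * n + d)) \<in> int_seq.span G" if "g \<in> int_seq.span G" "d < k" for g d
    using that(1)
  proof (induction rule: int_seq.span_induct_alt)
    case base
    have "(\<lambda>n. (0 :: nat \<Rightarrow> int) (k * n + d)) = 0" by (simp add: fun_eq_iff)
    then show ?case by (simp only: int_seq.span_zero)
  next
    case (step c x y)
    have "(\<lambda>n. (seq_scale c x + y) (k * n + d)) =
        seq_scale c (\<lambda>n. x (k * n + d)) + (\<lambda>n. y (k * n + d))"
      by (simp add: fun_eq_iff seq_scale_def)
    then show ?case
      using step decimate[OF _ that(2)] by (simp only: int_seq.span_add int_seq.span_scale)
  qed
  have "(\<lambda>n. w (k ^ e * n + c)) \<in> int_seq.span G" if "c < k ^ e" for e c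
    using that
  proof (induction e arbitrary: c)
    case 0
    then show ?case using w by simp
  next
    case (Suc e)
    have "k ^ e > 0" using k by simp
    then have "c mod k ^ e < k ^ e" "c div k ^ e < k"
      using Suc.prems by (simp_all add: less_mult_imp_div_less mult.commute)
    from span_decimate[OF Suc.IH[OF this(1)] this(2)]
    have "(\<lambda>n. w (k ^ e * (k * n + c div k ^ e) + c mod k ^ e)) \<in> int_seq.span G" .
    moreover have "k ^ e * (k * n + c div k ^ e) + c mod k ^ e = k ^ Suc e * n + c" for n
      by (simp add: distrib_left mult.assoc mult.left_commute)
    ultimately show ?case by simp
  qed
  then have "k_kernel k w \<subseteq> int_seq.span G" by (auto simp: k_kernel_def)
  with G have "int_seq.span G = int_seq.span (k_kernel k w)"
    by (simp add: int_seq.span_eq)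
  then show ?thesis using k fin by (auto simp: regular_seq_def)
qed

text \<open>
  The generators are the sequences $f(n)$, $f(n+1)$, $f(2n)$, $f(2n+1)$, $f(2n+2)$ together with the
  two inhomogeneous terms of the recurrences. All of them are combinations of $f(2^e n+c)$ with
  $e \le 3$: for instance $f(n+1)=f(4n+2)-f(n)$ and $1=f(8n+4)-2f(2n+1)$. The term supported at $0$
  keeps its coefficient $2$, as only this multiple arises as such a combination
  in the argument.
\<close>

lemma regular_seq_of_mod4_rec:
  fixes f :: "nat \<Rightarrow> int"
  assumes f0: "\<And>n. f (4 * n) = 2 * f n + 1 - (if n = 0 then 2 else 0)"
    and f1: "\<And>n. f (4 * n + 1) = 2 * f n"
    and f2: "\<And>n. f (4 * n + 2) = f n + f (n + 1)"
    and f3: "\<And>n. f (4 * n + 3) = 2 * f (n + 1)"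
  shows "regular_seq 2 f"
proof -
  define sub where "sub a b n = f (a * n + b)" for a b n
  define one :: "nat \<Rightarrow> int" where "one = (\<lambda>n. 1)"
  define origin_corr :: "nat \<Rightarrow> int" where "origin_corr n = (if n = 0 then 2 else 0)" for n
  define G where "G = {sub 1 0, sub 1 1, sub 2 0, sub 2 1, sub 2 2, one, origin_corr}"
  define K where "K = int_seq.span (k_kernel 2 f)"
  have f4: "f (4 * n + 4) = 2 * f (n + 1) + 1" for n
    using f0[of "n + 1"] by (simp add: algebra_simps)
  have sub4: "sub 4 0 = seq_scale 2 (sub 1 0) + one - origin_corr" "sub 4 1 = seq_scale 2 (sub 1 0)"
    "sub 4 2 = sub 1 0 + sub 1 1" "sub 4 3 = seq_scale 2 (sub 1 1)"
    "sub 4 4 = seq_scale 2 (sub 1 1) + one"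
    by (simp_all only: fun_eq_iff sub_def f0 f1 f2 f3 f4 one_def origin_corr_def seq_scale_def
          plus_fun_apply minus_apply add_0_right mult_1) simp_all
  have sub8: "sub 8 4 = seq_scale 2 (sub 2 1) + one" "sub 8 6 = sub 2 1 + sub 2 2"
    using f0[of "2 * n + 1" for n] f2[of "2 * n + 1" for n]
    by (simp_all add: fun_eq_iff sub_def one_def seq_scale_def algebra_simps)
  have kernel: "sub (2 ^ e) c \<in> K" if "c < 2 ^ e" for e c
    unfolding K_def using that
    by (intro int_seq.span_base) (auto simp: k_kernel_def sub_def[abs_def])
  have K: "sub 1 0 \<in> K" "sub 2 0 \<in> K" "sub 2 1 \<in> K" "sub 4 0 \<in> K" "sub 4 2 \<in> K"
    "sub 8 4 \<in> K" "sub 8 6 \<in> K"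
    using kernel[of 0 0] kernel[of 0 1] kernel[of 1 1] kernel[of 0 2] kernel[of 2 2]
      kernel[of 4 3] kernel[of 6 3] by simp_all
  have diff: "x - y \<in> K" if "x \<in> K" "y \<in> K" for x y
    using that unfolding K_def by (rule int_seq.span_diff)
  have add: "x + y \<in> K" if "x \<in> K" "y \<in> K" for x y
    using that unfolding K_def by (rule int_seq.span_add)
  have scale: "seq_scale c x \<in> K" if "x \<in> K" for c x
    using that unfolding K_def by (rule int_seq.span_scale)
  have "sub 1 1 \<in> K"
    using diff[OF K(5) K(1)] by (simp add: sub4)
  moreover have one: "one \<in> K"
    using diff[OF K(6) scale[OF K(3), of 2]] by (simp add: sub8)
  moreover have "sub 2 2 \<in> K"
    using diff[OF K(7) K(3)] by (simp add: sub8)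
  moreover have "origin_corr \<in> K"
    using diff[OF add[OF scale[OF K(1), of 2] one] K(4)] by (simp add: sub4)
  ultimately have GK: "G \<subseteq> K" using K by (simp add: G_def)
  have base: "g \<in> int_seq.span G" if "g \<in> G" for g
    using that by (rule int_seq.span_base)
  note G = base[of "sub 1 0"] base[of "sub 1 1"] base[of "sub 2 0"] base[of "sub 2 1"]
    base[of "sub 2 2"] base[of one] base[of origin_corr]
  have sub4_span: "sub 4 0 \<in> int_seq.span G" "sub 4 1 \<in> int_seq.span G"
    "sub 4 2 \<in> int_seq.span G" "sub 4 3 \<in> int_seq.span G" "sub 4 4 \<in> int_seq.span G"
    unfolding sub4 using G
    by (simp_all add: G_def int_seq.span_add int_seq.span_diff int_seq.span_scale)
  have sub_decimate: "(\<lambda>n. sub a b (2 * n + d)) = sub (2 * a) (a * d + b)" for a b d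
    by (simp add: sub_def fun_eq_iff algebra_simps)
  have one_decimate: "(\<lambda>n. one (2 * n + d)) = one" for d
    by (simp add: one_def)
  have origin_corr_decimate: "(\<lambda>n. origin_corr (2 * n + 0)) = origin_corr" "(\<lambda>n. origin_corr (2 * n + 1)) = 0"
    by (auto simp: origin_corr_def fun_eq_iff)
  show ?thesis
  proof (rule regular_seqI)
    show "finite G" by (simp add: G_def)
    have "f = sub 1 0" by (simp add: sub_def fun_eq_iff)
    then show "f \<in> int_seq.span G" using base[of "sub 1 0"] by (simp add: G_def)
    show "G \<subseteq> int_seq.span (k_kernel 2 f)" using GK by (simp add: K_def)
    fix g and d :: nat
    assume g: "g \<in> G" and "d < 2"
    then have d: "d = 0 \<or> d = 1" by auto
    show "(\<lambda>n. g (2 * n + d)) \<in> int_seq.span G"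
      using d g[unfolded G_def]
      by (elim disjE insertE emptyE; hypsubst)
        (simp_all only: sub_decimate one_decimate origin_corr_decimate int_seq.span_zero,
          insert G sub4_span, simp_all add: G_def del: One_nat_def add_2_eq_Suc add_2_eq_Suc')
  qed simp
qed

theorem theoremA:
  shows "(\<forall>n. abelian_complexity rudin_shapiro n = abelian_complexity rudin_shapiro' n) \<and>
    regular_seq 2 (\<lambda>n. int (abelian_complexity rudin_shapiro n))"
proof
  show "\<forall>n. abelian_complexity rudin_shapiro n = abelian_complexity rudin_shapiro' n"
    by (simp add: abelian_complexity_unit_letters rudin_shapiro_cases rudin_shapiro'_cases
        range_window_sum_rudin_shapiro')
  show "regular_seq 2 (\<lambda>n. int (abelian_complexity rudin_shapiro n))"
    unfolding abelian_complexity_rudin_shapiro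
    by (rule regular_seq_of_mod4_rec)
      (auto simp only: rs_peak_rec rs_peak_0, auto simp: rs_peak_rec rs_peak_0)
qed

end
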